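(* Let $n\ge p\ge 1$ be integers, let $m_1,\dots,m_n$ be positive integers, let $y_i\in\{0,1,\dots,m_i\}$ for $i=1,\dots,n$, let $x_1,\dots,x_n\in\mathbb{R}^p$, and let $X=(x_1,\dots,x_n)^{\top}\in\mathbb{R}^{n\times p}$ be the matrix with rows $x_i^{\top}$. Let $l^*$ be Firth's penalized log-likelihood of the binomial logistic regression model, $$l^*(\beta)=\sum_{i=1}^n\left[y_i x_i^{\top}\beta-m_i\log\{1+\exp(x_i^{\top}\beta)\}\right]+\frac12\log|X^{\top}MW(\beta)X|,\qquad \beta\in\mathbb{R}^p,$$ where $M=\operatorname{diag}(m_1,\dots,m_n)$ and $W(\beta)=\operatorname{diag}\{w_1(\beta),\dots,w_n(\beta)\}$ with $w_i(\beta)=\exp(x_i^{\top}\beta)/\{1+\exp(x_i^{\top}\beta)\}^2$. If $X$ is of full column rank, then there exists a maximizer $\hat\beta\in\mathbb{R}^p$ of $l^*$, that is, $l^*(\hat\beta)=\sup_{\beta\in\mathbb{R}^p}l^*(\beta)$, and the set of maximizers $\operatorname{argmax}_{\beta\in\mathbb{R}^p}l^*(\beta)$ is bounded.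
   Context: $|A|$ denotes the determinant of a square matrix $A$. The $y_i$ are realizations of independent $\operatorname{Bin}(m_i,\pi_i(\beta))$ variables with $\pi_i(\beta)=\exp(x_i^{\top}\beta)/\{1+\exp(x_i^{\top}\beta)\}$; note that $w_i(\beta)=\pi_i(\beta)\{1-\pi_i(\beta)\}$. The first sum in $l^*$ is the log-likelihood up to an additive constant not depending on $\beta$. A maximizer $\hat\beta$ is called Firth's modified estimate. *)

theory Defs
  imports "HOL-Analysis.Analysis"
begin

definition diag_mat :: "('n \<Rightarrow> real) \<Rightarrow> real ^ 'n ^ 'n" where
  "diag_mat d = (\<chi> i j. if i = j then d i else 0)"

text \<open>The design matrix \<open>X\<close> has the covariate vectors as rows, so \<open>X $ i\<close> is \<open>x\<^sub>i\<close>.\<close>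

definition firth_weight :: "real ^ 'p ^ 'n \<Rightarrow> real ^ 'p \<Rightarrow> 'n \<Rightarrow> real" where
  "firth_weight X \<beta> i = exp (X $ i \<bullet> \<beta>) / (1 + exp (X $ i \<bullet> \<beta>))\<^sup>2"

text \<open>If \<open>X\<close> has full column rank and all \<open>m i\<close> are positive, the determinant below is positive.
  Otherwise it can vanish, and then \<open>ln 0 = 0\<close> replaces the value minus infinity.\<close>

definition firth_loglik ::
  "('n::finite \<Rightarrow> nat) \<Rightarrow> ('n \<Rightarrow> nat) \<Rightarrow> real ^ 'p ^ 'n \<Rightarrow> real ^ 'p \<Rightarrow> real" where
  "firth_loglik m y X \<beta> =
     (\<Sum>i\<in>UNIV. real (y i) * (X $ i \<bullet> \<beta>) - real (m i) * ln (1 + exp (X $ i \<bullet> \<beta>)))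
     + 1 / 2 * ln (det (transpose X ** diag_mat (\<lambda>i. real (m i)) **
                        diag_mat (firth_weight X \<beta>) ** X))"

end

(* The log-likelihood part is nonpositive, so it suffices that the determinant tends to 0 as
   |beta| tends to infinity: then superlevel sets of the penalized log-likelihood are compact.
   Since w_i(beta) |x_i . beta| <= 1, along any sequence with |beta_k| -> infinity the weights and
   the directions beta_k / |beta_k| subconverge to some w and u with w_i (x_i . u) = 0 for all i.
   Hence u is in the kernel of X^T M diag(w) X, and the limiting determinant vanishes. *)

theory Submission
  imports Defs
begin

lemma diag_mat_mult_vec: "diag_mat d *v v = (\<chi> i. d i * v $ i)"
  by (simp add: diag_mat_def matrix_vector_mult_def vec_eq_iff if_distrib if_distribR
      sum.delta' cong: if_cong)

text \<open>This form reduces both determinant arguments to the numbers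
  \<open>a i * (b i * (X $ i \<bullet> v))\<close>: if all of them vanish, then \<open>v\<close> is
  in the kernel, and pairing with \<open>v\<close> gives a weighted sum of squares.\<close>

lemma weighted_gram_mult_vec:
  fixes X :: "real ^ 'p ^ 'n"
  shows "(transpose X ** diag_mat a ** diag_mat b ** X) *v v =
    transpose X *v (\<chi> i. a i * (b i * (X $ i \<bullet> v)))"
  by (simp add: matrix_vector_mul_assoc[symmetric] diag_mat_mult_vec matrix_vector_mul_component)

lemma det_eq_0_if_kernel:
  fixes A :: "real ^ 'p ^ 'p"
  assumes "A *v u = 0" "u \<noteq> 0"
  shows "det A = 0"
proof (rule ccontr)
  assume "det A \<noteq> 0"
  then obtain B where "B ** A = mat 1"
    unfolding invertible_det_nz[symmetric] invertible_def by blast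
  then have "u = B *v (A *v u)"
    by (simp add: matrix_vector_mul_assoc)
  with assms show False by simp
qed

text \<open>For a kernel vector \<open>v\<close> the quadratic form gives a vanishing sum of squares
  \<open>(X $ i \<bullet> v)\<^sup>2\<close> with positive weights, so \<open>X *v v = 0\<close>,
  and full column rank forces \<open>v = 0\<close>.\<close>

lemma det_weighted_gram_neq_0:
  fixes X :: "real ^ 'p ^ 'n"
  assumes pos: "\<And>i. 0 < a i" "\<And>i. 0 < b i" and "rank X = CARD('p)"
  shows "det (transpose X ** diag_mat a ** diag_mat b ** X) \<noteq> 0" (is "det ?A \<noteq> 0")
proof -
  have "v = 0" if "?A *v v = 0" for v
  proof -
    let ?c = "\<chi> i. a i * (b i * (X $ i \<bullet> v))"
    have "0 = (?A *v v) \<bullet> v"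
      using that by simp
    also have "\<dots> = ?c \<bullet> (X *v v)"
      unfolding weighted_gram_mult_vec by (simp add: dot_lmul_matrix)
    also have "\<dots> = (\<Sum>i\<in>UNIV. a i * b i * (X $ i \<bullet> v)\<^sup>2)"
      by (simp add: inner_vec_def[of ?c] matrix_vector_mul_component power2_eq_square mult_ac)
    finally have "(\<Sum>i\<in>UNIV. a i * b i * (X $ i \<bullet> v)\<^sup>2) = 0" by simp
    then have "a i * b i * (X $ i \<bullet> v)\<^sup>2 = 0" for i
      using pos by (subst (asm) sum_nonneg_eq_0_iff) (auto simp: less_imp_le)
    then have "X $ i \<bullet> v = 0" for i
      using pos by (metis mult_eq_0_iff less_irrefl power2_eq_square)
    then have "X *v v = X *v 0"
      by (simp add: vec_eq_iff matrix_vector_mul_component)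
    then show "v = 0"
      using assms(3) full_rank_injective[of X] by (metis injD)
  qed
  then have "\<exists>B. B ** ?A = mat 1"
    using matrix_left_invertible_ker by blast
  then show ?thesis
    by (metis invertible_det_nz invertible_left_inverse)
qed

text \<open>Once the sums over the diagonal matrices collapse, the determinant is a polynomial in
  the values \<open>b x i\<close>.\<close>

lemma continuous_on_det_weighted_gram:
  fixes X :: "real ^ 'p ^ 'n"
  assumes "\<And>i. continuous_on S (\<lambda>x. b x i)"
  shows "continuous_on S (\<lambda>x. det (transpose X ** diag_mat a ** diag_mat (b x) ** X))"
  unfolding det_def matrix_matrix_mult_def diag_mat_def
  by (simp add: if_distrib if_distribR sum.delta sum.delta' cong: if_cong)
    (intro continuous_intros assms)

lemma logistic_weight_le_1:
  fixes t :: real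
  shows "exp t / (1 + exp t)\<^sup>2 \<le> 1"
proof -
  have "exp t \<le> (1 + exp t)\<^sup>2"
    by (simp add: power2_sum)
  then show ?thesis
    by (simp add: divide_le_eq)
qed

text \<open>The weight decays exponentially on both sides. For \<open>t \<ge> 0\<close>,
  \<open>\<bar>t\<bar> \<le> exp t\<close> and the squared denominator absorbs
  \<open>exp t * exp t\<close>; for \<open>t < 0\<close>,
  \<open>\<bar>t\<bar> \<le> exp (- t)\<close> cancels the numerator.\<close>

lemma logistic_weight_mult_abs_le_1:
  fixes t :: real
  shows "exp t / (1 + exp t)\<^sup>2 * \<bar>t\<bar> \<le> 1"
proof -
  have "exp t * \<bar>t\<bar> \<le> (1 + exp t)\<^sup>2"
  proof (cases "0 \<le> t")
    case True
    have "\<bar>t\<bar> \<le> exp t"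
      using True exp_ge_add_one_self[of t] by linarith
    then have "exp t * \<bar>t\<bar> \<le> exp t * exp t"
      by (intro mult_left_mono) auto
    also have "\<dots> \<le> (1 + exp t)\<^sup>2"
      by (simp add: power2_eq_square algebra_simps)
    finally show ?thesis .
  next
    case False
    have "exp t * \<bar>t\<bar> \<le> exp t * exp (- t)"
      using False exp_ge_add_one_self[of "- t"] by (intro mult_left_mono) auto
    also have "\<dots> = 1"
      by (simp add: exp_minus)
    also have "\<dots> \<le> (1 + exp t)\<^sup>2"
      by simp
    finally show ?thesis .
  qed
  then show ?thesis
    by (simp add: divide_le_eq)
qed

lemma firth_weight_pos: "0 < firth_weight X \<beta> i"
  unfolding firth_weight_def by (intro divide_pos_pos zero_less_power add_pos_pos) auto

lemma continuous_on_firth_weight: "continuous_on S (\<lambda>\<beta>. firth_weight X \<beta> i)"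
  unfolding firth_weight_def
  by (intro continuous_intros) (metis add_pos_pos exp_gt_zero less_irrefl power_not_zero zero_less_one)

lemma det_weighted_gram_tendsto_0:
  fixes X :: "real ^ 'p ^ 'n" and \<beta> :: "nat \<Rightarrow> real ^ 'p"
  assumes lim: "filterlim (\<lambda>k. norm (\<beta> k)) at_top sequentially"
  shows "\<exists>r. strict_mono (r :: nat \<Rightarrow> nat) \<and>
    (\<lambda>k. det (transpose X ** diag_mat a ** diag_mat (firth_weight X (\<beta> (r k))) ** X)) \<longlonglongrightarrow> 0"
proof -
  \<comment> \<open>Taking a vector of weights as argument turns the determinant into a function on
    a Euclidean space, whose continuity can be applied at the limit \<open>w\<close>.\<close>
  define D where "D = (\<lambda>w :: real ^ 'n. det (transpose X ** diag_mat a ** diag_mat (($) w) ** X))"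
  \<comment> \<open>Pairing weights and directions lets one compactness argument yield a common
    subsequence for both.\<close>
  define z where "z = (\<lambda>k. (\<chi> i. firth_weight X (\<beta> k) i, sgn (\<beta> k)))"
  have "fst (z k) \<in> cbox 0 1" "snd (z k) \<in> cball 0 1" for k
    by (auto simp: z_def mem_box_cart less_imp_le[OF firth_weight_pos] norm_sgn)
      (simp add: firth_weight_def logistic_weight_le_1)
  then have "z k \<in> cbox 0 1 \<times> cball 0 1" for k
    by (simp add: mem_Times_iff)
  moreover have "compact (cbox (0 :: real ^ 'n) 1 \<times> cball (0 :: real ^ 'p) 1)"
    by (intro compact_Times) auto
  ultimately obtain l r where r: "strict_mono r" and "(z \<circ> r) \<longlonglongrightarrow> l"
    unfolding compact_def by blast
  moreover obtain w u where "l = (w, u)" by force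
  ultimately have zr: "(\<lambda>k. z (r k)) \<longlonglongrightarrow> (w, u)" by (simp add: o_def)
  have w: "(\<lambda>k. \<chi> i. firth_weight X (\<beta> (r k)) i) \<longlonglongrightarrow> w"
    using tendsto_fst[OF zr] by (simp add: z_def)
  have u: "(\<lambda>k. sgn (\<beta> (r k))) \<longlonglongrightarrow> u"
    using tendsto_snd[OF zr] by (simp add: z_def)
  have lim_r: "filterlim (\<lambda>k. norm (\<beta> (r k))) at_top sequentially"
    using filterlim_compose[OF lim filterlim_subseq[OF r]] .
  \<comment> \<open>Since \<open>sgn 0 = 0\<close>, the norm is 1 only once
    \<open>\<beta> (r k)\<close> is nonzero. In the limit this gives \<open>norm u = 1\<close>, so
    the kernel vector \<open>u\<close> is not zero.\<close>
  have "eventually (\<lambda>k. norm (sgn (\<beta> (r k))) = 1) sequentially"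
    using filterlim_at_top_dense[THEN iffD1, OF lim_r, rule_format, of 0]
    by eventually_elim (auto simp: norm_sgn)
  then have "(\<lambda>k. norm (sgn (\<beta> (r k)))) \<longlonglongrightarrow> 1"
    by (rule tendsto_eventually)
  with tendsto_norm[OF u] have "norm u = 1"
    by (rule LIMSEQ_unique)
  then have "u \<noteq> 0" by auto
  have "w $ i * (X $ i \<bullet> u) = 0" for i
  proof -
    have "(\<lambda>k. firth_weight X (\<beta> (r k)) i) \<longlonglongrightarrow> w $ i"
      using tendsto_vec_nth[OF w, of i] by simp
    then have 1: "(\<lambda>k. firth_weight X (\<beta> (r k)) i * (X $ i \<bullet> sgn (\<beta> (r k)))) \<longlonglongrightarrow> w $ i * (X $ i \<bullet> u)"
      using u by (intro tendsto_intros)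
    \<comment> \<open>Normalizing divides the bounded product of weight and linear predictor by
      \<open>norm b\<close>. At \<open>b = 0\<close> both sides are 0, because
      \<open>inverse 0 = 0\<close>.\<close>
    have "norm (firth_weight X b i * (X $ i \<bullet> sgn b)) \<le> inverse (norm b)" for b
    proof -
      have "norm (firth_weight X b i * (X $ i \<bullet> sgn b)) =
          (firth_weight X b i * \<bar>X $ i \<bullet> b\<bar>) * inverse (norm b)"
        using firth_weight_pos[of X b i] by (simp add: sgn_div_norm abs_mult)
      also have "\<dots> \<le> 1 * inverse (norm b)"
        unfolding firth_weight_def by (intro mult_right_mono logistic_weight_mult_abs_le_1) auto
      finally show ?thesis by simp
    qed
    then have 2: "(\<lambda>k. firth_weight X (\<beta> (r k)) i * (X $ i \<bullet> sgn (\<beta> (r k)))) \<longlonglongrightarrow> 0"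
      by (intro Lim_null_comparison[OF always_eventually
            tendsto_inverse_0_at_top[OF lim_r]]) blast
    show ?thesis
      using LIMSEQ_unique[OF 1 2] .
  qed
  then have "(\<chi> i. a i * (w $ i * (X $ i \<bullet> u))) = 0"
    by (simp add: vec_eq_iff)
  then have "(transpose X ** diag_mat a ** diag_mat (($) w) ** X) *v u = 0"
    unfolding weighted_gram_mult_vec by simp
  then have "D w = 0"
    unfolding D_def using \<open>u \<noteq> 0\<close> by (rule det_eq_0_if_kernel)
  have "continuous_on UNIV D"
    unfolding D_def by (intro continuous_on_det_weighted_gram continuous_intros)
  then have "isCont D w"
    by (simp add: continuous_on_eq_continuous_at)
  from isCont_tendsto_compose[OF this w] \<open>D w = 0\<close>
  have "(\<lambda>k. D (\<chi> i. firth_weight X (\<beta> (r k)) i)) \<longlonglongrightarrow> 0" by simp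
  \<comment> \<open>\<open>vec_lambda_inverse\<close> turns the coordinates of the weight vector
    back into the function \<open>firth_weight X (\<beta> (r k))\<close>.\<close>
  then show ?thesis
    using r unfolding D_def vec_lambda_inverse[OF UNIV_I] by blast
qed

text \<open>Both \<open>t \<le> ln (1 + exp t)\<close> and \<open>0 \<le> ln (1 + exp t)\<close>
  hold; the first handles the factor \<open>y\<close>, the second allows \<open>y\<close> to be
  raised to \<open>m\<close>.\<close>

lemma binomial_loglik_nonpos:
  fixes t :: real
  assumes "y \<le> m"
  shows "real y * t - real m * ln (1 + exp t) \<le> 0"
proof -
  have "t \<le> ln (1 + exp t)"
    using ln_le_cancel_iff[of "exp t" "1 + exp t"] by (simp add: add_pos_pos)
  then have "real y * t \<le> real y * ln (1 + exp t)"
    by (intro mult_left_mono) auto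
  also have "\<dots> \<le> real m * ln (1 + exp t)"
    using assms by (intro mult_right_mono) auto
  finally show ?thesis by simp
qed

text \<open>The only delicate point is the logarithm of the determinant, whose argument never
  vanishes by positivity of the weights and full rank.\<close>

lemma continuous_on_firth_loglik:
  fixes X :: "real ^ 'p ^ 'n"
  assumes "\<And>i. 0 < m i" "rank X = CARD('p)"
  shows "continuous_on S (firth_loglik m y X)"
proof -
  have "1 + exp t \<noteq> 0" for t :: real
    by (metis add_pos_pos exp_gt_zero less_irrefl zero_less_one)
  then show ?thesis
    unfolding firth_loglik_def [abs_def]
    using assms
    by (intro continuous_intros continuous_on_det_weighted_gram continuous_on_firth_weight
        ballI det_weighted_gram_neq_0 firth_weight_pos) auto
qed

lemma bounded_superlevel_firth_loglik:
  fixes X :: "real ^ 'p ^ 'n"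
  assumes m: "\<And>i. 0 < m i" and y: "\<And>i. y i \<le> m i" and X: "rank X = CARD('p)"
  shows "bounded {\<beta>. C \<le> firth_loglik m y X \<beta>}"
proof (rule ccontr)
  let ?d = "\<lambda>\<beta>. det (transpose X ** diag_mat (\<lambda>i. real (m i)) ** diag_mat (firth_weight X \<beta>) ** X)"
  assume "\<not> ?thesis"
  then have "\<exists>\<beta>. C \<le> firth_loglik m y X \<beta> \<and> real k < norm \<beta>" for k
    unfolding bounded_iff by (auto simp: not_le)
  then obtain \<beta> where \<beta>: "\<And>k. C \<le> firth_loglik m y X (\<beta> k)" "\<And>k. real k < norm (\<beta> k)"
    by metis
  have "filterlim (\<lambda>k. norm (\<beta> k)) at_top sequentially"
    by (rule filterlim_at_top_mono[OF filterlim_real_sequentially])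
      (simp add: \<beta>(2) less_imp_le)
  then obtain r where "(\<lambda>k. ?d (\<beta> (r k))) \<longlonglongrightarrow> 0"
    using det_weighted_gram_tendsto_0 by blast
  then have "(\<lambda>k. \<bar>?d (\<beta> (r k))\<bar>) \<longlonglongrightarrow> 0"
    by (rule tendsto_rabs_zero)
  \<comment> \<open>As the log-likelihood part is nonpositive, the penalty alone must reach
    \<open>C\<close>, that is, \<open>C \<le> 1 / 2 * ln (?d b)\<close>. This keeps the determinant
    away from 0 on the superlevel set.\<close>
  moreover have "exp (2 * C) \<le> \<bar>?d b\<bar>" if "C \<le> firth_loglik m y X b" for b
  proof -
    have "?d b \<noteq> 0"
      using m X by (intro det_weighted_gram_neq_0 firth_weight_pos) auto
    have "(\<Sum>i\<in>UNIV. real (y i) * (X $ i \<bullet> b) - real (m i) * ln (1 + exp (X $ i \<bullet> b))) \<le> 0"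
      using y by (intro sum_nonpos binomial_loglik_nonpos)
    then have "2 * C \<le> ln (?d b)"
      using that unfolding firth_loglik_def by linarith
    then have "exp (2 * C) \<le> exp (ln (?d b))" by simp
    also have "\<dots> = \<bar>?d b\<bar>"
      \<comment> \<open>\<open>ln\<close> on the reals satisfies \<open>ln (- x) = ln x\<close>, so the sign of the determinant is irrelevant.\<close>
      using \<open>?d b \<noteq> 0\<close> by (rule exp_ln_abs)
    finally show ?thesis .
  qed
  ultimately have "exp (2 * C) \<le> 0"
    using \<beta>(1) by (intro LIMSEQ_le_const) auto
  then show False by simp
qed

theorem theorem1:
  fixes X :: "real ^ 'p ^ 'n" and m y :: "'n \<Rightarrow> nat"
  assumes "CARD('p) \<le> CARD('n)"
    and "\<And>i. 0 < m i"
    and "\<And>i. y i \<le> m i"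
    and "rank X = CARD('p)"
  shows "(\<exists>\<beta>. is_arg_max (firth_loglik m y X) (\<lambda>_. True) \<beta> \<and>
              bdd_above (range (firth_loglik m y X)) \<and>
              firth_loglik m y X \<beta> = (SUP b. firth_loglik m y X b)) \<and>
         bounded {\<beta>. is_arg_max (firth_loglik m y X) (\<lambda>_. True) \<beta>}"
proof -
  let ?l = "firth_loglik m y X"
  \<comment> \<open>The level \<open>?l 0\<close> makes the set nonempty, as it contains 0, and
    every maximizer reaches this level. So one bounded set serves both existence and
    boundedness.\<close>
  let ?S = "{\<beta>. ?l 0 \<le> ?l \<beta>}"
  have bounded: "bounded ?S"
    using assms(2-4) by (rule bounded_superlevel_firth_loglik)
  have cont: "continuous_on T ?l" for T
    using assms(2,4) by (rule continuous_on_firth_loglik)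
  have "closed ?S"
    by (intro closed_Collect_le cont continuous_intros)
  with bounded have "compact ?S"
    by (simp add: compact_eq_bounded_closed)
  moreover have "0 \<in> ?S" by simp
  ultimately obtain b where b: "b \<in> ?S" "\<forall>c\<in>?S. ?l c \<le> ?l b"
    using continuous_attains_sup[OF _ _ cont, of ?S] by blast
  \<comment> \<open>Outside \<open>?S\<close> the values lie below \<open>?l 0\<close>, hence below
    \<open>?l b\<close>, so the maximum over \<open>?S\<close> is global.\<close>
  have max: "?l c \<le> ?l b" for c
    using b by (cases "c \<in> ?S") auto
  have "is_arg_max ?l (\<lambda>_. True) b"
    using max by (simp add: is_arg_max_def not_less)
  moreover have "bdd_above (range ?l)"
    using max by (intro bdd_aboveI2)
  moreover have "?l b = (SUP c. ?l c)"
    using max by (intro cSup_eq_maximum[symmetric]) auto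
  moreover have "{\<beta>. is_arg_max ?l (\<lambda>_. True) \<beta>} \<subseteq> ?S"
    by (auto simp: is_arg_max_def not_less)
  ultimately show ?thesis
    using bounded bounded_subset by blast
qed

end
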